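(* Let $\{\xi^k\}_{k\ge0}$ be a sequence generated, from a given $\xi^0\in\mathbb{R}^{(p+1)m}$, by the rank-two relaxed parallel splitting ALM (defined in the context) with $\beta>0$ and $\alpha\in(0,2)$ applied to the problem $\min\{\sum_{i=1}^p\theta_i(x_i) \mid \sum_{i=1}^pA_ix_i=b,\ x_i\in\mathcal{X}_i,\ i=1,\dots,p\}$, and let $\tilde w^k=(\tilde x_1^k;\dots;\tilde x_p^k;\tilde\lambda^k)$ be the corresponding outputs of its parallel splitting step. For every integer $N>0$ let $$\bar w_N=(\bar x_N;\bar\lambda_N):=\frac{1}{N+1}\sum_{k=0}^N\tilde w^k .$$ Suppose that $(x^*,\lambda^* )\in\Omega$ is a saddle point of the Lagrangian $L(x,\lambda)=\theta(x)-\lambda^T(\mathcal{A}x-b)$ over $\Omega$. Then $$\theta(\bar x_N)-\theta(x^* )\le O(1/N)\quad\text{and}\quad \|\mathcal{A}\bar x_N-b\|\le O(1/N),$$ i.e. there is a constant $C\ge0$ independent of $N$ such that $\theta(\bar x_N)-\theta(x^* )\le C/N$ and $\|\mathcal{A}\bar x_N-b\|\le C/N$ for every integer $N>0$.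
   Context: Problem and standing assumptions: $p\ge 2$; for $i=1,\dots,p$, $\theta_i:\mathbb{R}^{n_i}\to\mathbb{R}$ is a closed, proper, convex (not necessarily smooth) function, $\mathcal{X}_i\subseteq\mathbb{R}^{n_i}$ is a closed convex set, $A_i\in\mathbb{R}^{m\times n_i}$ has full column rank, and $b\in\mathbb{R}^m$. The solution set of $\min\{\sum_{i=1}^p\theta_i(x_i) \mid \sum_{i=1}^pA_ix_i=b,\ x_i\in\mathcal{X}_i\}$ is nonempty. Notation: $x=(x_1;\dots;x_p)$, $w=(x_1;\dots;x_p;\lambda)$ with $\lambda\in\mathbb{R}^m$, $\theta(x)=\sum_{i=1}^p\theta_i(x_i)$, $\mathcal{A}=[A_1,\dots,A_p]$ (so $\mathcal{A}x=\sum_iA_ix_i$), $\Omega=\mathcal{X}_1\times\cdots\times\mathcal{X}_p\times\mathbb{R}^m$. A saddle point of $L$ over $\Omega$ is $(x^*,\lambda^* )\in\Omega$ with $L(x^*,\lambda)\le L(x^*,\lambda^* )\le L(x,\lambda^* )$ for all $(x,\lambda)\in\Omega$. Let $P=\mathrm{diag}(A_1,\dots,A_p,I_m)$ (block diagonal), so $Pw=(A_1x_1;\dots;A_px_p;\lambda)$. Matrices ($(p+1)\times(p+1)$ blocks of size $m\times m$): $\mathcal{D}=\mathrm{diag}(\beta I_m,\dots,\beta I_m,\frac1\beta I_m)$ (with $p$ copies of $\beta I_m$); $\mathcal{Q}$ has diagonal blocks $\beta I_m$ in positions $(i,i)$, $i\le p$, block $I_m$ in positions $(i,p+1)$, $i\le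 p$, block $-I_m$ in positions $(p+1,i)$, $i\le p$, block $\frac1\beta I_m$ in position $(p+1,p+1)$, and zero blocks elsewhere; $\mathcal{M}=\mathcal{Q}^{-T}\mathcal{D}$. Algorithm (rank-two relaxed parallel splitting ALM): given $\xi^k=(\xi^k_1;\dots;\xi^k_p;\lambda^k)\in\mathbb{R}^{(p+1)m}$ (the block $\xi_i^k\in\mathbb{R}^m$ is the quantity denoted "$A_ix_i^k$"), the parallel splitting step computes for $i=1,\dots,p$ $$\tilde x_i^k\in\arg\min\Big\{\theta_i(x_i)-(\lambda^k)^TA_ix_i+\tfrac{\beta}{2}\|A_ix_i-\xi_i^k\|^2 \;\Big|\; x_i\in\mathcal{X}_i\Big\},\qquad \tilde\lambda^k=\lambda^k-\beta\Big(\sum_{i=1}^p\xi_i^k-b\Big),$$ with output $\tilde w^k=(\tilde x_1^k;\dots;\tilde x_p^k;\tilde\lambda^k)$ and $\tilde\xi^k=P\tilde w^k$; the relaxation step sets $\xi^{k+1}=\xi^k-\alpha\mathcal{M}(\xi^k-\tilde\xi^k)$, where $\alpha\in(0,2)$. *)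

theory Defs
  imports "HOL-Analysis.Analysis"
begin

text \<open>
  The blocks are indexed by a finite type \<open>'p\<close>, so \<open>p = CARD('p)\<close>. As the dimensions \<open>n\<^sub>i\<close> differ
  from block to block, \<open>\<real>\<close> to the power \<open>n\<^sub>i\<close> is the coordinate subspace of \<open>real ^ 'n\<close> spanned
  by the coordinates in a set \<open>J i\<close> with \<open>n\<^sub>i = card (J i)\<close>; norm, topology and convexity are the
  inherited ones. A matrix with \<open>n\<^sub>i\<close> columns is a matrix over \<open>'n\<close> whose columns
  outside \<open>J i\<close> are zero, which does not change its rank. Since \<open>'n\<close> and \<open>J\<close> are arbitrary,
  every family of dimensions is covered.
  The stacked vector \<open>x = (x\<^sub>1; \<dots>; x\<^sub>p)\<close> has type \<open>real ^ 'n ^ 'p\<close>, and \<open>w = (x; \<lambda>)\<close> is a pair.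
\<close>

definition coord_space :: "'n set \<Rightarrow> (real ^ 'n::finite) set" where
  "coord_space J = {x. \<forall>j. j \<notin> J \<longrightarrow> x $ j = 0}"

definition matrix_on_coords :: "'n set \<Rightarrow> real ^ 'n::finite ^ 'm::finite \<Rightarrow> bool" where
  "matrix_on_coords J A \<longleftrightarrow> (\<forall>j. j \<notin> J \<longrightarrow> column j A = 0)"

definition full_column_rank_on :: "'n set \<Rightarrow> real ^ 'n::finite ^ 'm::finite \<Rightarrow> bool" where
  "full_column_rank_on J A \<longleftrightarrow> matrix_on_coords J A \<and> rank A = card J"

text \<open>Properness needs no clause: it is automatic for a real-valued function.\<close>

definition closed_proper_convex_on :: "(real ^ 'n::finite) set \<Rightarrow> (real ^ 'n \<Rightarrow> real) \<Rightarrow> bool" where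
  "closed_proper_convex_on V f \<longleftrightarrow> convex_on V f \<and> closed (epigraph V f)"

definition objective :: "('p \<Rightarrow> real ^ 'n::finite \<Rightarrow> real) \<Rightarrow> real ^ 'n ^ 'p::finite \<Rightarrow> real" where
  "objective \<theta> x = (\<Sum>i\<in>UNIV. \<theta> i (x $ i))"

definition constraint_map ::
  "('p \<Rightarrow> real ^ 'n::finite ^ 'm::finite) \<Rightarrow> real ^ 'n ^ 'p::finite \<Rightarrow> real ^ 'm" where
  "constraint_map A x = (\<Sum>i\<in>UNIV. A i *v (x $ i))"

definition solution_set ::
  "('p \<Rightarrow> real ^ 'n::finite \<Rightarrow> real) \<Rightarrow> ('p \<Rightarrow> (real ^ 'n) set) \<Rightarrow>
   ('p \<Rightarrow> real ^ 'n ^ 'm::finite) \<Rightarrow> real ^ 'm \<Rightarrow> (real ^ 'n ^ 'p::finite) set" where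
  "solution_set \<theta> X A b =
     {x. is_arg_min (objective \<theta>) (\<lambda>x. constraint_map A x = b \<and> (\<forall>i. x $ i \<in> X i)) x}"

definition Lagrangian ::
  "('p \<Rightarrow> real ^ 'n::finite \<Rightarrow> real) \<Rightarrow> ('p \<Rightarrow> real ^ 'n ^ 'm::finite) \<Rightarrow> real ^ 'm \<Rightarrow>
   real ^ 'n ^ 'p::finite \<Rightarrow> real ^ 'm \<Rightarrow> real" where
  "Lagrangian \<theta> A b x l = objective \<theta> x - l \<bullet> (constraint_map A x - b)"

definition Omega ::
  "('p \<Rightarrow> (real ^ 'n::finite) set) \<Rightarrow> ((real ^ 'n ^ 'p::finite) \<times> (real ^ 'm::finite)) set" where
  "Omega X = {x. \<forall>i. x $ i \<in> X i} \<times> UNIV"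

definition saddle_point ::
  "('x \<Rightarrow> 'l \<Rightarrow> real) \<Rightarrow> ('x \<times> 'l) set \<Rightarrow> 'x \<Rightarrow> 'l \<Rightarrow> bool" where
  "saddle_point L S x_star l_star \<longleftrightarrow> (x_star, l_star) \<in> S \<and>
     (\<forall>(x, l)\<in>S. L x_star l \<le> L x_star l_star \<and> L x_star l_star \<le> L x l_star)"

text \<open>
  Vectors with \<open>p + 1\<close> blocks in \<open>\<real>\<close> to the power \<open>m\<close> have index type \<open>'p option \<times> 'm\<close>:
  \<open>Some i\<close> is the \<open>i\<close>-th block and \<open>None\<close> the last one (the multiplier).
\<close>

definition block :: "real ^ ('k::finite \<times> 'm::finite) \<Rightarrow> 'k \<Rightarrow> real ^ 'm" where
  "block \<xi> I = (\<chi> a. \<xi> $ (I, a))"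

definition stack :: "('k \<Rightarrow> real ^ 'm::finite) \<Rightarrow> real ^ ('k::finite \<times> 'm)" where
  "stack v = (\<chi> Ia. v (fst Ia) $ snd Ia)"

definition block_matrix ::
  "('k \<Rightarrow> 'k \<Rightarrow> real ^ 'm::finite ^ 'm) \<Rightarrow> real ^ ('k::finite \<times> 'm) ^ ('k \<times> 'm)" where
  "block_matrix B = (\<chi> Ia Jc. B (fst Ia) (fst Jc) $ snd Ia $ snd Jc)"

text \<open>\<open>P = diag(A\<^sub>1, \<dots>, A\<^sub>p, I)\<close>, as a linear map.\<close>

definition P_map ::
  "('p \<Rightarrow> real ^ 'n::finite ^ 'm::finite) \<Rightarrow> (real ^ 'n ^ 'p::finite) \<times> (real ^ 'm) \<Rightarrow>
   real ^ ('p option \<times> 'm)" where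
  "P_map A w = stack (\<lambda>I. case I of Some i \<Rightarrow> A i *v (fst w $ i) | None \<Rightarrow> snd w)"

definition D_mat :: "real \<Rightarrow> real ^ ('p::finite option \<times> 'm::finite) ^ ('p option \<times> 'm)" where
  "D_mat \<beta> = block_matrix (\<lambda>I J. if I = J
     then (case I of Some i \<Rightarrow> mat \<beta> | None \<Rightarrow> mat (1 / \<beta>)) else 0)"

definition Q_mat :: "real \<Rightarrow> real ^ ('p::finite option \<times> 'm::finite) ^ ('p option \<times> 'm)" where
  "Q_mat \<beta> = block_matrix (\<lambda>I J. case (I, J) of
       (Some i, Some j) \<Rightarrow> if i = j then mat \<beta> else 0
     | (Some i, None) \<Rightarrow> mat 1
     | (None, Some j) \<Rightarrow> - mat 1
     | (None, None) \<Rightarrow> mat (1 / \<beta>))"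

definition M_mat :: "real \<Rightarrow> real ^ ('p::finite option \<times> 'm::finite) ^ ('p option \<times> 'm)" where
  "M_mat \<beta> = matrix_inv (transpose (Q_mat \<beta>)) ** D_mat \<beta>"

text \<open>The subproblem minimisers may fail to be unique, so the step is a relation.\<close>

definition parallel_splitting_step ::
  "('p \<Rightarrow> real ^ 'n::finite \<Rightarrow> real) \<Rightarrow> ('p \<Rightarrow> (real ^ 'n) set) \<Rightarrow>
   ('p \<Rightarrow> real ^ 'n ^ 'm::finite) \<Rightarrow> real ^ 'm \<Rightarrow> real \<Rightarrow>
   real ^ ('p::finite option \<times> 'm) \<Rightarrow> (real ^ 'n ^ 'p) \<times> (real ^ 'm) \<Rightarrow> bool" where
  "parallel_splitting_step \<theta> X A b \<beta> \<xi> w \<longleftrightarrow>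
     (\<forall>i. is_arg_min
            (\<lambda>y. \<theta> i y - block \<xi> None \<bullet> (A i *v y)
                  + \<beta> / 2 * (norm (A i *v y - block \<xi> (Some i)))\<^sup>2)
            (\<lambda>y. y \<in> X i) (fst w $ i)) \<and>
     snd w = block \<xi> None - \<beta> *\<^sub>R ((\<Sum>i\<in>UNIV. block \<xi> (Some i)) - b)"

definition rank_two_relaxed_PSALM ::
  "('p \<Rightarrow> real ^ 'n::finite \<Rightarrow> real) \<Rightarrow> ('p \<Rightarrow> (real ^ 'n) set) \<Rightarrow>
   ('p \<Rightarrow> real ^ 'n ^ 'm::finite) \<Rightarrow> real ^ 'm \<Rightarrow> real \<Rightarrow> real \<Rightarrow>
   (nat \<Rightarrow> real ^ ('p::finite option \<times> 'm)) \<Rightarrow> (nat \<Rightarrow> (real ^ 'n ^ 'p) \<times> (real ^ 'm)) \<Rightarrow> bool" where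
  "rank_two_relaxed_PSALM \<theta> X A b \<beta> \<alpha> \<xi> w \<longleftrightarrow>
     (\<forall>k. parallel_splitting_step \<theta> X A b \<beta> (\<xi> k) (w k) \<and>
          \<xi> (Suc k) = \<xi> k - \<alpha> *\<^sub>R (M_mat \<beta> *v (\<xi> k - P_map A (w k))))"

definition ergodic_mean :: "(nat \<Rightarrow> 'a::real_vector) \<Rightarrow> nat \<Rightarrow> 'a" where
  "ergodic_mean w N = (1 / (real N + 1)) *\<^sub>R (\<Sum>k=0..N. w k)"

end

theory Submission
  imports Defs
begin

text \<open>
  Write \<open>pred = P w\<close> for the output \<open>w\<close> of one splitting step and \<open>z = P (x, l)\<close> for a comparison
  point. The optimality conditions of the \<open>p\<close> subproblems, together with the formula for the predicted
  multiplier, bound the duality gap \<open>L (fst w) l - L x (snd w)\<close> by the bilinear expression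
  \<open>(z - pred) \<bullet> Q (pred - \<xi>)\<close> (lemma \<open>predictor_lagrangian_gap\<close>). The matrix \<open>M\<close> of the relaxation
  step is made for this expression: since \<open>Q + Q\<^sup>T = 2 D\<close> and \<open>Q\<^sup>T M = D\<close>, it is at most the decrease of
  \<open>\<parallel>Q\<^sup>T (z - \<xi>)\<parallel>\<^sup>2 / (2 \<alpha>)\<close> in the step from \<open>\<xi>\<close> to its successor, with the norm weighted by \<open>D\<inverse>\<close>;
  the remainder is a nonnegative multiple of \<open>2 - \<alpha>\<close> (lemma \<open>lyapunov_decrease\<close>).
  The decreases telescope.

  Averaging and Jensen's inequality give, for every multiplier \<open>l\<close>,
  \<open>L x\<^sub>N l - \<theta> x_star \<le> V l / (N + 1)\<close> at the ergodic mean \<open>x\<^sub>N\<close>, where \<open>V\<close> is continuous and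
  independent of \<open>N\<close> (lemma \<open>ergodic_lagrangian_gap\<close>). The multiplier is free, and both rates
  come from choosing it. With \<open>l = 0\<close> the Lagrangian is the objective. For the residual \<open>r\<close> of the
  constraint, take \<open>l\<close> to be \<open>l_star\<close> minus the unit vector along \<open>r\<close>: the saddle-point inequality
  \<open>\<theta> x_star \<le> L x\<^sub>N l_star\<close> then leaves exactly \<open>\<parallel>r\<parallel>\<close> on the left. Such multipliers stay in the unit
  ball around \<open>l_star\<close>, which is compact, so one constant bounds \<open>V\<close> at all of them.
\<close>

section \<open>Proximal steps and ergodic means\<close>

text \<open>
  The subproblem is a nonsmooth convex function plus a differentiable quadratic. Comparing the minimiser
  with the points of the segment towards \<open>x\<close> and letting these tend to the minimiser linearises the
  quadratic, while convexity lets \<open>f\<close> enter through its values at the two endpoints only.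
\<close>

lemma prox_variational_inequality:
  fixes A :: "real ^ 'n::finite ^ 'm::finite"
  assumes cvx: "convex_on X f"
    and y: "is_arg_min (\<lambda>y. f y - l \<bullet> (A *v y) + \<beta> / 2 * (norm (A *v y - c))\<^sup>2) (\<lambda>y. y \<in> X) y"
    and x: "x \<in> X"
  shows "f y - f x \<le> (A *v y - A *v x) \<bullet> (l - \<beta> *\<^sub>R (A *v y - c))"
proof -
  define d where "d = A *v x - A *v y"
  define q where "q = (A *v y - c) \<bullet> d"
  define s where "s = f x - f y - l \<bullet> d + \<beta> * q"
  have yX: "y \<in> X" using y by (simp add: is_arg_min_def)
  \<comment> \<open>\<open>s\<close> bounds the slope of the subproblem objective at \<open>y\<close> towards \<open>x\<close> from above.\<close>
  have step: "0 \<le> s + t * (\<beta> / 2 * (d \<bullet> d))" if t: "0 < t" "t < 1" for t :: real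
  proof -
    define z where "z = (1 - t) *\<^sub>R y + t *\<^sub>R x"
    have zX: "z \<in> X"
      using convex_on_imp_convex[OF cvx] yX x t unfolding z_def by (simp add: convexD)
    have fz: "f z \<le> (1 - t) * f y + t * f x"
      using convex_onD[OF cvx, of t y x] t yX x unfolding z_def by simp
    have Az: "A *v z = A *v y + t *\<^sub>R d"
      unfolding z_def d_def
      by (simp add: matrix_vector_right_distrib matrix_vector_mult_scaleR algebra_simps)
    have min: "f y - l \<bullet> (A *v y) + \<beta> / 2 * (norm (A *v y - c))\<^sup>2
        \<le> f z - l \<bullet> (A *v z) + \<beta> / 2 * (norm (A *v z - c))\<^sup>2"
      using y zX by (auto simp: is_arg_min_linorder)
    have quad: "(norm (A *v z - c))\<^sup>2 = (norm (A *v y - c))\<^sup>2 + 2 * t * q + t\<^sup>2 * (d \<bullet> d)"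
      unfolding Az q_def power2_norm_eq_inner
      unfolding power2_eq_square
      by (simp add: inner_add_left inner_add_right inner_diff_left inner_diff_right
          inner_commute algebra_simps)
    have "l \<bullet> (A *v z) = l \<bullet> (A *v y) + t * (l \<bullet> d)"
      by (simp add: Az inner_add_right)
    then have "0 \<le> t * (s + t * (\<beta> / 2 * (d \<bullet> d)))"
      using min fz unfolding s_def quad by (simp add: algebra_simps power2_eq_square)
    then show ?thesis using t by (simp add: zero_le_mult_iff)
  qed
  have "((\<lambda>t. s + t * (\<beta> / 2 * (d \<bullet> d))) \<longlongrightarrow> s + 0 * (\<beta> / 2 * (d \<bullet> d))) (at_right 0)"
    by (intro tendsto_intros)
  then have "0 \<le> s + 0 * (\<beta> / 2 * (d \<bullet> d))"
  proof (rule tendsto_lowerbound)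
    show "\<forall>\<^sub>F t in at_right 0. 0 \<le> s + t * (\<beta> / 2 * (d \<bullet> d))"
      using step by (intro eventually_at_rightI[of 0 1]) auto
  qed simp
  then show ?thesis
    unfolding s_def q_def d_def
    by (simp add: inner_diff_left inner_diff_right inner_commute algebra_simps)
qed

lemma ergodic_mean_linear:
  assumes "linear f"
  shows "f (ergodic_mean w N) = ergodic_mean (\<lambda>k. f (w k)) N"
  using assms by (simp add: ergodic_mean_def linear_scale linear_sum)

lemma ergodic_mean_diff: "ergodic_mean (\<lambda>k. f k - g k) N = ergodic_mean f N - ergodic_mean g N"
  by (simp add: ergodic_mean_def sum_subtractf scaleR_diff_right)

lemma ergodic_mean_const: "ergodic_mean (\<lambda>k. c) N = c"
  by (simp add: ergodic_mean_def sum_constant_scaleR add.commute)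

lemma ergodic_mean_eq_sum:
  "ergodic_mean w N = (\<Sum>k=0..N. (1 / (real N + 1)) *\<^sub>R w k)"
  by (simp add: ergodic_mean_def scaleR_right.sum)

lemma ergodic_mean_in_convex:
  assumes "convex S" "\<And>k. w k \<in> S"
  shows "ergodic_mean w N \<in> S"
  unfolding ergodic_mean_eq_sum by (rule convex_sum) (use assms in auto)

lemma ergodic_mean_jensen:
  assumes "convex_on S f" "\<And>k. w k \<in> S"
  shows "f (ergodic_mean w N) \<le> ergodic_mean (\<lambda>k. f (w k)) N"
proof -
  have "f (\<Sum>k=0..N. (1 / (real N + 1)) *\<^sub>R w k) \<le> (\<Sum>k=0..N. (1 / (real N + 1)) * f (w k))"
    by (rule convex_on_sum) (use assms in auto)
  then show ?thesis unfolding ergodic_mean_eq_sum by simp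
qed

lemma ergodic_mean_telescope:
  fixes g V :: "nat \<Rightarrow> real"
  assumes step: "\<And>k. g k \<le> V k - V (Suc k)" and "\<And>k. 0 \<le> V k"
  shows "ergodic_mean g N \<le> V 0 / (real N + 1)"
proof -
  have "(\<Sum>k=0..N. g k) \<le> (\<Sum>k=0..N. V k - V (Suc k))"
    by (rule sum_mono) (rule step)
  also have "\<dots> = V 0 - V (Suc N)"
    by (induction N) auto
  also have "\<dots> \<le> V 0" using assms(2) by simp
  finally show ?thesis by (simp add: ergodic_mean_def divide_right_mono)
qed

section \<open>Relaxed correction steps in a quadratic norm\<close>

text \<open>
  With \<open>E = D\<inverse>\<close> this is the squared norm \<open>u \<bullet> H u\<close> for \<open>H = Q D\<inverse> Q\<^sup>T\<close>, the matrix with \<open>H M = Q\<close> that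
  is usual in the analysis of prediction-correction methods. In the coordinates \<open>Q\<^sup>T u\<close> the correction
  by \<open>M\<close> becomes a step along \<open>D v\<close>.
\<close>

definition lyapunov :: "real ^ 'k::finite ^ 'k \<Rightarrow> real ^ 'k ^ 'k \<Rightarrow> real ^ 'k \<Rightarrow> real" where
  "lyapunov Q E u = (transpose Q *v u) \<bullet> (E *v (transpose Q *v u))"

lemma inner_transpose_matrix_vector:
  fixes Q :: "real ^ 'k::finite ^ 'l::finite"
  shows "(transpose Q *v u) \<bullet> v = u \<bullet> (Q *v v)"
  by (metis dot_lmul_matrix inner_commute transpose_matrix_vector)

text \<open>
  Put \<open>v = old - pred\<close> and \<open>g = Q\<^sup>T (z - old)\<close>. The new value of \<open>Q\<^sup>T (z - _)\<close> is \<open>g + \<alpha> D v\<close>, so the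
  squared norm changes by \<open>2 \<alpha> (g \<bullet> v) + \<alpha>\<^sup>2 (v \<bullet> D v)\<close>, and \<open>g \<bullet> v = (z - pred) \<bullet> Q v - v \<bullet> D v\<close>. So
  the decrease divided by \<open>2 \<alpha>\<close> exceeds \<open>(z - pred) \<bullet> Q (pred - old)\<close> by \<open>(2 - \<alpha>) / 2\<close> times
  \<open>v \<bullet> D v\<close>: this is where the range of the relaxation factor enters.
\<close>

lemma lyapunov_decrease:
  fixes Q D E M :: "real ^ 'k::finite ^ 'k"
  assumes QD: "\<And>v. v \<bullet> (Q *v v) = v \<bullet> (D *v v)"
    and D: "\<And>v. 0 \<le> v \<bullet> (D *v v)"
    and E: "\<And>u v. u \<bullet> (E *v v) = (E *v u) \<bullet> v" "E ** D = mat 1"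
    and M: "transpose Q ** M = D"
    and \<alpha>: "0 < \<alpha>" "\<alpha> < 2"
    and new: "new = old - \<alpha> *\<^sub>R (M *v (old - pred))"
  shows "(z - pred) \<bullet> (Q *v (pred - old))
     \<le> (lyapunov Q E (z - old) - lyapunov Q E (z - new)) / (2 * \<alpha>)"
proof -
  define v where "v = old - pred"
  define g where "g = transpose Q *v (z - old)"
  have znew: "z - new = (z - old) + \<alpha> *\<^sub>R (M *v v)"
    using new by (simp add: v_def)
  have "transpose Q *v (z - new) = g + \<alpha> *\<^sub>R (transpose Q *v (M *v v))"
    by (simp only: znew g_def matrix_vector_right_distrib matrix_vector_mult_scaleR)
  also have "transpose Q *v (M *v v) = D *v v"
    by (simp only: matrix_vector_mul_assoc M)
  finally have step: "transpose Q *v (z - new) = g + \<alpha> *\<^sub>R (D *v v)" .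
  have ED: "E *v (D *v v) = v"
    by (simp add: matrix_vector_mul_assoc E)
  have "lyapunov Q E (z - new) = g \<bullet> (E *v g) + 2 * \<alpha> * (g \<bullet> v) + \<alpha>\<^sup>2 * (v \<bullet> (D *v v))"
    unfolding lyapunov_def step
    using E(1)[of "D *v v" g]
    by (simp add: matrix_vector_right_distrib matrix_vector_mult_scaleR ED inner_add_left
        inner_add_right inner_commute algebra_simps power2_eq_square)
  moreover have "lyapunov Q E (z - old) = g \<bullet> (E *v g)"
    by (simp add: lyapunov_def g_def)
  moreover have "g \<bullet> v = (z - pred) \<bullet> (Q *v v) - v \<bullet> (D *v v)"
  proof -
    have "g \<bullet> v = (z - old) \<bullet> (Q *v v)"
      by (simp only: g_def inner_transpose_matrix_vector)
    also have "z - old = (z - pred) - v" by (simp add: v_def)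
    finally show ?thesis by (simp add: inner_diff_left QD)
  qed
  moreover have "(z - pred) \<bullet> (Q *v (pred - old)) = - ((z - pred) \<bullet> (Q *v v))"
    by (simp add: v_def matrix_vector_mult_diff_distrib inner_diff_right)
  moreover have "\<alpha>\<^sup>2 * (v \<bullet> (D *v v)) \<le> 2 * \<alpha> * (v \<bullet> (D *v v))"
    by (rule mult_right_mono) (use \<alpha> D in \<open>auto simp: power2_eq_square\<close>)
  ultimately have "2 * \<alpha> * ((z - pred) \<bullet> (Q *v (pred - old)))
      \<le> lyapunov Q E (z - old) - lyapunov Q E (z - new)"
    by (simp add: right_diff_distrib)
  then show ?thesis using \<alpha> by (simp add: field_simps)
qed

section \<open>The block matrices of the method\<close>

lemma inner_block:
  fixes u v :: "real ^ ('k::finite \<times> 'm::finite)"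
  shows "u \<bullet> v = (\<Sum>I\<in>UNIV. block u I \<bullet> block v I)"
  by (simp add: inner_vec_def block_def sum.cartesian_product)

lemma block_eqI: "(\<And>I. block u I = block v I) \<Longrightarrow> u = v"
  by (simp add: block_def vec_eq_iff)

lemma block_diff: "block (u - v) I = block u I - block v I"
  by (simp add: block_def vec_eq_iff)

lemma block_zero [simp]: "block 0 I = 0"
  by (simp add: block_def vec_eq_iff)

lemma block_stack: "block (stack v) I = v I"
  by (simp add: block_def stack_def vec_eq_iff)

lemma block_P_map:
  "block (P_map A w) (Some i) = A i *v (fst w $ i)"
  "block (P_map A w) None = snd w"
  by (simp_all add: P_map_def block_stack)

lemma block_matrix_vector:
  fixes B :: "'k::finite \<Rightarrow> 'k \<Rightarrow> real ^ 'm::finite ^ 'm"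
  shows "block (block_matrix B *v v) I = (\<Sum>J\<in>UNIV. B I J *v block v J)"
  by (simp add: block_def block_matrix_def matrix_vector_mult_def vec_eq_iff
      sum.cartesian_product split_def)

lemma mat_vector_mult: "mat c *v (v :: real ^ 'm::finite) = c *\<^sub>R v"
  by (simp add: mat_def matrix_vector_mult_def vec_eq_iff if_distrib[of "\<lambda>x. x * _"] cong: if_cong)

lemma uminus_matrix_vector_mult: "(- B) *v (v :: real ^ 'n::finite) = - (B *v v)"
  by (simp add: matrix_vector_mult_def vec_eq_iff sum_negf)

lemma sum_UNIV_option:
  fixes f :: "'p::finite option \<Rightarrow> 'a::comm_monoid_add"
  shows "(\<Sum>I\<in>UNIV. f I) = f None + (\<Sum>i\<in>UNIV. f (Some i))"
  by (simp add: UNIV_option_conv sum.reindex)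

lemma block_D_mat:
  "block (D_mat \<beta> *v v) (Some i) = \<beta> *\<^sub>R block v (Some i)"
  "block (D_mat \<beta> *v v) None = (1 / \<beta>) *\<^sub>R block v None"
  by (simp_all add: D_mat_def block_matrix_vector sum_UNIV_option mat_vector_mult
      if_distrib[of "\<lambda>B. B *v _"] cong: if_cong)

lemma block_Q_mat:
  "block (Q_mat \<beta> *v v) (Some i) = \<beta> *\<^sub>R block v (Some i) + block v None"
  "block (Q_mat \<beta> *v v) None = (1 / \<beta>) *\<^sub>R block v None - (\<Sum>i\<in>UNIV. block v (Some i))"
  by (simp_all add: Q_mat_def block_matrix_vector sum_UNIV_option mat_vector_mult
      uminus_matrix_vector_mult if_distrib[of "\<lambda>B. B *v _"] sum_negf cong: if_cong)

text \<open>The off-diagonal blocks of \<open>Q\<close> form a skew matrix, hence cancel in the quadratic form.\<close>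

lemma Q_mat_quadratic_form: "v \<bullet> (Q_mat \<beta> *v v) = v \<bullet> (D_mat \<beta> *v v)"
  by (simp add: inner_block sum_UNIV_option block_D_mat block_Q_mat inner_add_right
      inner_diff_right inner_sum_right sum.distrib inner_commute)

lemma D_mat_symmetric: "u \<bullet> (D_mat \<beta> *v v) = (D_mat \<beta> *v u) \<bullet> v"
  by (simp add: inner_block sum_UNIV_option block_D_mat)

lemma D_mat_inverse:
  assumes "\<beta> > 0"
  shows "D_mat (1 / \<beta>) ** D_mat \<beta>
    = (mat 1 :: real ^ ('p::finite option \<times> 'm::finite) ^ ('p option \<times> 'm))"
proof -
  have "block (D_mat (1 / \<beta>) *v (D_mat \<beta> *v v)) I = block v I"
    for v :: "real ^ ('p option \<times> 'm)" and I
    using assms by (cases I) (simp_all add: block_D_mat)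
  then have "D_mat (1 / \<beta>) *v (D_mat \<beta> *v v) = v" for v :: "real ^ ('p option \<times> 'm)"
    by (rule block_eqI)
  then show ?thesis
    by (simp add: matrix_eq flip: matrix_vector_mul_assoc)
qed

lemma D_mat_nonneg: "\<beta> > 0 \<Longrightarrow> 0 \<le> v \<bullet> (D_mat \<beta> *v v)"
  by (simp add: inner_block sum_UNIV_option block_D_mat sum_nonneg)

lemma D_mat_pos_def:
  assumes "\<beta> > 0" "v \<bullet> (D_mat \<beta> *v v) = 0"
  shows "v = 0"
proof (rule block_eqI)
  fix I
  have s: "0 \<le> \<beta> * (\<Sum>i\<in>UNIV. block v (Some i) \<bullet> block v (Some i))"
    using assms by (simp add: sum_nonneg)
  have n: "0 \<le> (1 / \<beta>) * (block v None \<bullet> block v None)"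
    using assms by simp
  have "(1 / \<beta>) * (block v None \<bullet> block v None)
      + \<beta> * (\<Sum>i\<in>UNIV. block v (Some i) \<bullet> block v (Some i)) = 0"
    using assms(2) by (simp add: inner_block sum_UNIV_option block_D_mat sum_distrib_left)
  then have "(1 / \<beta>) * (block v None \<bullet> block v None) = 0"
    "\<beta> * (\<Sum>i\<in>UNIV. block v (Some i) \<bullet> block v (Some i)) = 0"
    using s n by linarith+
  then show "block v I = block 0 I"
    using assms(1) by (cases I) (simp_all add: sum_nonneg_eq_0_iff)
qed

text \<open>
  The content is that \<open>Q\<^sup>T\<close> is invertible: its quadratic form is the positive definite one of \<open>D\<close>,
  so its kernel is trivial.
\<close>

lemma transpose_Q_mat_M_mat:
  assumes "\<beta> > 0"
  shows "transpose (Q_mat \<beta>) ** M_mat \<beta>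
    = (D_mat \<beta> :: real ^ ('p::finite option \<times> 'm::finite) ^ ('p option \<times> 'm))"
proof -
  let ?Q = "Q_mat \<beta> :: real ^ ('p option \<times> 'm) ^ ('p option \<times> 'm)"
  have "u = 0" if "transpose ?Q *v u = 0" for u
  proof -
    have "u \<bullet> (D_mat \<beta> *v u) = (transpose ?Q *v u) \<bullet> u"
      by (simp only: inner_transpose_matrix_vector Q_mat_quadratic_form)
    with that show ?thesis using D_mat_pos_def[OF assms] by simp
  qed
  then have "invertible (transpose ?Q)"
    by (metis invertible_left_inverse matrix_left_invertible_ker)
  then have "transpose ?Q ** matrix_inv (transpose ?Q) = mat 1"
    unfolding invertible_def matrix_inv_def by (rule someI2_ex) simp
  then show ?thesis
    by (simp add: M_mat_def matrix_mul_assoc)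
qed

section \<open>The convergence rate\<close>

lemma constraint_map_linear: "linear (constraint_map A)"
  by (rule linearI)
    (simp_all add: constraint_map_def matrix_vector_right_distrib sum.distrib
      matrix_vector_mult_scaleR scaleR_right.sum)

text \<open>
  The Lagrangian is affine in the multiplier, and moving the multiplier against the residual \<open>r\<close>
  raises it by \<open>r \<bullet> r\<close>.
\<close>

lemma saddle_point_feasible:
  assumes "saddle_point (Lagrangian \<theta> A b) (Omega X) x_star l_star"
  shows "constraint_map A x_star = b"
proof -
  let ?r = "constraint_map A x_star - b"
  have "Lagrangian \<theta> A b x_star (l_star - ?r) \<le> Lagrangian \<theta> A b x_star l_star"
    using assms by (force simp: saddle_point_def Omega_def)
  then have "?r \<bullet> ?r \<le> 0"
    by (simp add: Lagrangian_def inner_diff_left)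
  then show ?thesis
    by (metis inner_ge_zero inner_eq_zero_iff order_antisym right_minus_eq)
qed

text \<open>
  The subproblems see the old multiplier. Rewriting their optimality conditions with the predicted
  multiplier \<open>snd w\<close> produces the error terms \<open>\<beta> V\<^sub>i + U\<close>, which are the first \<open>p\<close> block rows of \<open>Q\<close>
  applied to \<open>P w - \<xi>\<close>. The last block row of that product is the primal residual
  \<open>b - constraint_map A (fst w)\<close>, by the multiplier update. In this sense \<open>Q\<close> is
  read off from the splitting step.
\<close>

lemma predictor_lagrangian_gap:
  fixes A :: "'p::finite \<Rightarrow> real ^ 'n::finite ^ 'm::finite"
  assumes \<beta>: "\<beta> > 0"
    and cvx: "\<And>i. convex_on (X i) (\<theta> i)"
    and step: "parallel_splitting_step \<theta> X A b \<beta> \<xi> w"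
    and x: "\<And>i. x $ i \<in> X i"
  shows "Lagrangian \<theta> A b (fst w) l - Lagrangian \<theta> A b x (snd w)
     \<le> (P_map A (x, l) - P_map A w) \<bullet> (Q_mat \<beta> *v (P_map A w - \<xi>))"
proof -
  define V where "V i = A i *v (fst w $ i) - block \<xi> (Some i)" for i
  define U where "U = snd w - block \<xi> None"
  have U: "(1 / \<beta>) *\<^sub>R U = b - (\<Sum>i\<in>UNIV. block \<xi> (Some i))"
    using step \<beta> by (simp add: U_def parallel_splitting_step_def)
  have VI: "\<theta> i (fst w $ i) - \<theta> i (x $ i)
      \<le> (A i *v (fst w $ i) - A i *v (x $ i)) \<bullet> (snd w - (\<beta> *\<^sub>R V i + U))" for i
  proof -
    have "\<theta> i (fst w $ i) - \<theta> i (x $ i) \<le> (A i *v (fst w $ i) - A i *v (x $ i)) \<bullet>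
        (block \<xi> None - \<beta> *\<^sub>R (A i *v (fst w $ i) - block \<xi> (Some i)))"
      by (rule prox_variational_inequality[OF cvx])
        (use step x in \<open>auto simp: parallel_splitting_step_def\<close>)
    then show ?thesis by (simp add: V_def U_def algebra_simps)
  qed
  let ?g = "\<lambda>i. A i *v (fst w $ i) - A i *v (x $ i)"
  have "objective \<theta> (fst w) - objective \<theta> x \<le> (\<Sum>i\<in>UNIV. ?g i \<bullet> (snd w - (\<beta> *\<^sub>R V i + U)))"
    unfolding objective_def sum_subtractf[symmetric] by (rule sum_mono) (rule VI)
  also have "\<dots> = (constraint_map A (fst w) - constraint_map A x) \<bullet> snd w
      - (\<Sum>i\<in>UNIV. ?g i \<bullet> (\<beta> *\<^sub>R V i + U))"
    by (simp add: constraint_map_def inner_diff_right sum_subtractf inner_sum_left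
        flip: sum_subtractf)
  finally have obj: "objective \<theta> (fst w) - objective \<theta> x
    \<le> (constraint_map A (fst w) - constraint_map A x) \<bullet> snd w
      - (\<Sum>i\<in>UNIV. ?g i \<bullet> (\<beta> *\<^sub>R V i + U))" .
  have "(1 / \<beta>) *\<^sub>R U - (\<Sum>i\<in>UNIV. V i) = b - constraint_map A (fst w)"
    unfolding U by (simp add: V_def constraint_map_def sum_subtractf)
  then have "(P_map A (x, l) - P_map A w) \<bullet> (Q_mat \<beta> *v (P_map A w - \<xi>))
    = (l - snd w) \<bullet> (b - constraint_map A (fst w)) - (\<Sum>i\<in>UNIV. ?g i \<bullet> (\<beta> *\<^sub>R V i + U))"
    by (simp add: inner_block sum_UNIV_option block_Q_mat block_diff block_P_map
        inner_diff_left sum_subtractf flip: V_def U_def)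
  with obj show ?thesis
    by (simp add: Lagrangian_def inner_diff_left inner_diff_right inner_commute)
qed

lemma predictor_in_X:
  "rank_two_relaxed_PSALM \<theta> X A b \<beta> \<alpha> \<xi> w \<Longrightarrow> fst (w k) $ i \<in> X i"
  by (auto simp: rank_two_relaxed_PSALM_def parallel_splitting_step_def is_arg_min_def)

lemma ergodic_mean_component:
  fixes w :: "nat \<Rightarrow> (('a::real_vector ^ 'p::finite) \<times> 'b::real_vector)"
  shows "fst (ergodic_mean w N) $ i = ergodic_mean (\<lambda>k. fst (w k) $ i) N"
  by (rule ergodic_mean_linear) (auto intro!: linearI)

text \<open>
  At a feasible \<open>x\<close> the value \<open>L x (snd (w k))\<close> is \<open>\<theta> x\<close> for every \<open>k\<close>. The one-step gaps are therefore
  measured against a fixed number, and as \<open>L\<close> is convex in its first argument their average bounds the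
  gap of the ergodic mean.
\<close>

lemma ergodic_lagrangian_gap:
  fixes A :: "'p::finite \<Rightarrow> real ^ 'n::finite ^ 'm::finite"
  assumes \<beta>: "\<beta> > 0" and \<alpha>: "0 < \<alpha>" "\<alpha> < 2"
    and cvx: "\<And>i. convex_on (X i) (\<theta> i)"
    and alg: "rank_two_relaxed_PSALM \<theta> X A b \<beta> \<alpha> \<xi> w"
    and x: "\<And>i. x $ i \<in> X i" and feas: "constraint_map A x = b"
  shows "Lagrangian \<theta> A b (fst (ergodic_mean w N)) l - objective \<theta> x
     \<le> lyapunov (Q_mat \<beta>) (D_mat (1 / \<beta>)) (P_map A (x, l) - \<xi> 0) / (2 * \<alpha>) / (real N + 1)"
proof -
  define V where
    "V k = lyapunov (Q_mat \<beta>) (D_mat (1 / \<beta>)) (P_map A (x, l) - \<xi> k) / (2 * \<alpha>)" for k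
  have step: "Lagrangian \<theta> A b (fst (w k)) l - objective \<theta> x \<le> V k - V (Suc k)" for k
  proof -
    have "Lagrangian \<theta> A b (fst (w k)) l - objective \<theta> x
        = Lagrangian \<theta> A b (fst (w k)) l - Lagrangian \<theta> A b x (snd (w k))"
      by (simp add: Lagrangian_def feas)
    also have "\<dots> \<le> (P_map A (x, l) - P_map A (w k)) \<bullet> (Q_mat \<beta> *v (P_map A (w k) - \<xi> k))"
      by (rule predictor_lagrangian_gap[OF \<beta> cvx])
        (use alg x in \<open>auto simp: rank_two_relaxed_PSALM_def\<close>)
    also have "\<dots> \<le> V k - V (Suc k)"
      unfolding V_def diff_divide_distrib[symmetric]
      by (rule lyapunov_decrease[OF Q_mat_quadratic_form D_mat_nonneg[OF \<beta>] D_mat_symmetric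
            D_mat_inverse[OF \<beta>] transpose_Q_mat_M_mat[OF \<beta>] \<alpha>])
        (use alg in \<open>simp add: rank_two_relaxed_PSALM_def\<close>)
    finally show ?thesis .
  qed
  have V_nonneg: "0 \<le> V k" for k
    unfolding V_def lyapunov_def using \<alpha> \<beta> by (simp add: D_mat_nonneg)
  let ?xbar = "fst (ergodic_mean w N)"
  have "objective \<theta> ?xbar \<le> (\<Sum>i\<in>UNIV. ergodic_mean (\<lambda>k. \<theta> i (fst (w k) $ i)) N)"
    unfolding objective_def ergodic_mean_component
    by (rule sum_mono) (rule ergodic_mean_jensen[OF cvx predictor_in_X[OF alg]])
  also have "\<dots> = ergodic_mean (\<lambda>k. objective \<theta> (fst (w k))) N"
    unfolding ergodic_mean_def objective_def
    by (subst sum.swap) (simp add: sum_distrib_left)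
  finally have obj: "objective \<theta> ?xbar \<le> ergodic_mean (\<lambda>k. objective \<theta> (fst (w k))) N" .
  have "linear (\<lambda>v. l \<bullet> constraint_map A (fst v))"
    using constraint_map_linear[of A]
    by (auto intro!: linearI simp: linear_add linear_scale inner_add_right)
  from ergodic_mean_linear[OF this]
  have con: "l \<bullet> constraint_map A ?xbar = ergodic_mean (\<lambda>k. l \<bullet> constraint_map A (fst (w k))) N" .
  have "ergodic_mean (\<lambda>k. Lagrangian \<theta> A b (fst (w k)) l - objective \<theta> x) N
      = ergodic_mean (\<lambda>k. objective \<theta> (fst (w k))) N
        - (ergodic_mean (\<lambda>k. l \<bullet> constraint_map A (fst (w k))) N - l \<bullet> b) - objective \<theta> x"
    unfolding Lagrangian_def inner_diff_right by (simp add: ergodic_mean_diff ergodic_mean_const)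
  with obj have "Lagrangian \<theta> A b ?xbar l - objective \<theta> x
      \<le> ergodic_mean (\<lambda>k. Lagrangian \<theta> A b (fst (w k)) l - objective \<theta> x) N"
    unfolding Lagrangian_def inner_diff_right con by linarith
  also have "\<dots> \<le> V 0 / (real N + 1)"
    by (rule ergodic_mean_telescope[where V = V]) (rule step V_nonneg)+
  finally show ?thesis by (simp add: V_def)
qed

text \<open>The norm of \<open>r\<close> is attained by pairing it with its own direction \<open>sgn r\<close>, at \<open>u = l - sgn r\<close>.\<close>

lemma norm_le_of_dual_bound:
  fixes r l :: "'a::real_inner"
  assumes "\<And>u. u \<in> cball l 1 \<Longrightarrow> (l - u) \<bullet> r \<le> c"
  shows "norm r \<le> c"
proof -
  have "norm r = (l - (l - sgn r)) \<bullet> r"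
    by (cases "r = 0")
      (simp_all add: sgn_div_norm power2_eq_square flip: power2_norm_eq_inner)
  also have "\<dots> \<le> c"
    by (rule assms) (simp add: dist_norm norm_sgn)
  finally show ?thesis .
qed

lemma continuous_lyapunov_multiplier:
  "continuous_on S (\<lambda>l. lyapunov Q E (P_map A (x, l) - c))"
proof -
  have "continuous_on S (\<lambda>l. P_map A (x, l) $ (I, a))" for I a
    by (cases I) (auto simp: P_map_def stack_def intro!: continuous_intros)
  then have "continuous_on S (\<lambda>l. \<chi> Ia. P_map A (x, l) $ Ia)"
    by (intro continuous_on_vec_lambda) (metis surj_pair)
  then have "continuous_on S (\<lambda>l. P_map A (x, l))" by simp
  then show ?thesis
    unfolding lyapunov_def
    by (intro continuous_intros matrix_vector_mult_linear_continuous_on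
        continuous_on_compose2[OF matrix_vector_mult_linear_continuous_on]) auto
qed

theorem theorem5p1:
  fixes J :: "'p::finite \<Rightarrow> 'n::finite set"
    and \<theta> :: "'p \<Rightarrow> real ^ 'n \<Rightarrow> real"
    and X :: "'p \<Rightarrow> (real ^ 'n) set"
    and A :: "'p \<Rightarrow> real ^ 'n ^ 'm::finite"
    and b :: "real ^ 'm"
    and \<alpha> \<beta> :: real
    and \<xi> :: "nat \<Rightarrow> real ^ ('p option \<times> 'm)"
    and w :: "nat \<Rightarrow> (real ^ 'n ^ 'p) \<times> (real ^ 'm)"
    and x_star :: "real ^ 'n ^ 'p"
    and l_star :: "real ^ 'm"
  assumes "CARD('p) \<ge> 2"
    and "\<And>i. closed_proper_convex_on (coord_space (J i)) (\<theta> i)"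
    and "\<And>i. X i \<subseteq> coord_space (J i)"
    and "\<And>i. closed (X i)"
    and "\<And>i. convex (X i)"
    and "\<And>i. full_column_rank_on (J i) (A i)"
    and "solution_set \<theta> X A b \<noteq> {}"
    and "\<beta> > 0"
    and "0 < \<alpha>" and "\<alpha> < 2"
    and "rank_two_relaxed_PSALM \<theta> X A b \<beta> \<alpha> \<xi> w"
    and "saddle_point (Lagrangian \<theta> A b) (Omega X) x_star l_star"
  shows "\<exists>C\<ge>0. \<forall>N::nat. N > 0 \<longrightarrow>
           objective \<theta> (fst (ergodic_mean w N)) - objective \<theta> x_star \<le> C / real N \<and>
           norm (constraint_map A (fst (ergodic_mean w N)) - b) \<le> C / real N"
proof -
  note \<beta> = assms(8) and \<alpha> = assms(9,10) and alg = assms(11) and saddle = assms(12)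
  have cvx: "convex_on (X i) (\<theta> i)" for i
    using assms(2)[of i] convex_on_subset[OF _ assms(3,5)]
    by (simp add: closed_proper_convex_on_def)
  have feas: "constraint_map A x_star = b"
    by (rule saddle_point_feasible[OF saddle])
  have xX: "x_star $ i \<in> X i" for i
    using saddle by (auto simp: saddle_point_def Omega_def)
  define V where
    "V l = lyapunov (Q_mat \<beta>) (D_mat (1 / \<beta>)) (P_map A (x_star, l) - \<xi> 0) / (2 * \<alpha>)" for l
  have gap: "Lagrangian \<theta> A b (fst (ergodic_mean w N)) l - objective \<theta> x_star
      \<le> V l / (real N + 1)" for N l
    unfolding V_def by (rule ergodic_lagrangian_gap[OF \<beta> \<alpha> cvx alg xX feas])
  \<comment> \<open>The point \<open>0\<close> serves the objective, the unit ball around \<open>l_star\<close> the constraint residual.\<close>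
  have "continuous_on (insert 0 (cball l_star 1)) V"
    unfolding V_def using \<alpha> by (intro continuous_intros continuous_lyapunov_multiplier) auto
  then have "bounded (V ` insert 0 (cball l_star 1))"
    by (intro compact_imp_bounded compact_continuous_image) auto
  then obtain C where C: "0 < C" "\<And>l. l \<in> insert 0 (cball l_star 1) \<Longrightarrow> V l \<le> C"
    by (force simp: bounded_pos)
  have *: "objective \<theta> (fst (ergodic_mean w N)) - objective \<theta> x_star \<le> C / real N \<and>
      norm (constraint_map A (fst (ergodic_mean w N)) - b) \<le> C / real N" if N: "N > 0" for N
  proof -
    let ?xbar = "fst (ergodic_mean w N)"
    have rate: "V l / (real N + 1) \<le> C / real N" if "l \<in> insert 0 (cball l_star 1)" for l
      using C(1) C(2)[OF that] N by (intro frac_le) auto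
    have "?xbar $ i \<in> X i" for i
      unfolding ergodic_mean_component
      by (rule ergodic_mean_in_convex[OF assms(5)]) (rule predictor_in_X[OF alg])
    then have "Lagrangian \<theta> A b x_star l_star \<le> Lagrangian \<theta> A b ?xbar l_star"
      using saddle by (force simp: saddle_point_def Omega_def)
    then have lower: "objective \<theta> x_star \<le> Lagrangian \<theta> A b ?xbar l_star"
      by (simp add: Lagrangian_def feas)
    have "norm (constraint_map A ?xbar - b) \<le> C / real N"
    proof (rule norm_le_of_dual_bound[where l = l_star])
      fix u assume u: "u \<in> cball l_star 1"
      have "(l_star - u) \<bullet> (constraint_map A ?xbar - b)
          = Lagrangian \<theta> A b ?xbar u - Lagrangian \<theta> A b ?xbar l_star"
        by (simp add: Lagrangian_def inner_diff_left)
      also have "\<dots> \<le> V u / (real N + 1)"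
        using gap[of N u] lower by simp
      also have "\<dots> \<le> C / real N" using u by (intro rate) auto
      finally show "(l_star - u) \<bullet> (constraint_map A ?xbar - b) \<le> C / real N" .
    qed
    moreover have "objective \<theta> ?xbar - objective \<theta> x_star \<le> C / real N"
      using gap[of N 0] rate[of 0] by (simp add: Lagrangian_def)
    ultimately show ?thesis by blast
  qed
  show ?thesis using C(1) * by (intro exI[of _ C]) auto
qed

end
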